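(* For every $n\ge0$, let $\mathrm{Cat}_A(n)$ denote the number of decompositions of $\Delta_{n+1}^+$ into exactly $n$ non-empty inversion sets. Then $\mathrm{Cat}_A(n)=\frac1{n+1}\binom{2n}{n}$, the $n$-th Catalan number.
   Context: $\Delta_k^+=\{(i,j)\mid1\le i<j\le k\}$; for $\alpha\in S_k$ the inversion set is $\Phi(\alpha)=\{(i,j)\in\Delta_k^+\mid\alpha(i)>\alpha(j)\}$. A decomposition of $\Delta_k^+$ into exactly $k-1$ non-empty inversion sets is an expression $\Delta_k^+=\Phi(\alpha_1)\sqcup\dots\sqcup\Phi(\alpha_{k-1})$ as a disjoint union with $\alpha_i\in S_k$ and all $\Phi(\alpha_i)\neq\emptyset$; the order of the sets is disregarded. For $k=1$, $\Delta_1^+=\emptyset$ has exactly one such decomposition (the empty one). *)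

theory Defs
  imports Complex_Main "HOL-Combinatorics.Permutations" "HOL-Library.Disjoint_Sets"
begin

definition pos_roots :: "nat \<Rightarrow> (nat \<times> nat) set" where
  "pos_roots k = {(i, j). 1 \<le> i \<and> i < j \<and> j \<le> k}"

definition inv_set :: "nat \<Rightarrow> (nat \<Rightarrow> nat) \<Rightarrow> (nat \<times> nat) set" where
  "inv_set k \<alpha> = {(i, j) \<in> pos_roots k. \<alpha> i > \<alpha> j}"

text \<open>
  The order of the parts is disregarded and disjoint non-empty parts are distinct, so a
  decomposition is a set of inversion sets; \<^const>\<open>partition_on\<close> says that its members are
  non-empty, pairwise disjoint and have union \<open>pos_roots k\<close>. Elements of $S_k$ are the functions
  permuting \<open>{1..k}\<close>.
\<close>
definition inv_decompositions :: "nat \<Rightarrow> nat \<Rightarrow> (nat \<times> nat) set set set" where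
  "inv_decompositions k m =
     {P. partition_on (pos_roots k) P \<and>
         (\<forall>B\<in>P. \<exists>\<alpha>. \<alpha> permutes {1..k} \<and> B = inv_set k \<alpha>) \<and>
         card P = m}"

definition Cat_A :: "nat \<Rightarrow> nat" where
  "Cat_A n = card (inv_decompositions (n + 1) n)"

end

(* Inversion sets are exactly the sets of roots that are closed and co-closed under
   (i, j), (j, l) |-> (i, l); each nonempty one contains a simple root (i, i+1). So in a
   decomposition into n parts every part has exactly one simple root, and naming parts by it turns
   decompositions into colourings c of the intervals {i..<j} with c(i, i+1) = i and
   c(i, l) in {c(i, j), c(j, l)}. If r is the colour of the whole interval, every subinterval
   containing r has colour r, and the colourings to the left and to the right of r are arbitrary.
   This is the Catalan recurrence. *)

theory Submission
  imports Defs
begin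

section \<open>Inversion sets as closed and co-closed sets of roots\<close>

definition biclosed :: "nat \<Rightarrow> (nat \<times> nat) set \<Rightarrow> bool" where
  "biclosed k B \<longleftrightarrow> B \<subseteq> pos_roots k \<and>
     (\<forall>i j l. 1 \<le> i \<and> i < j \<and> j < l \<and> l \<le> k \<longrightarrow>
        ((i, j) \<in> B \<and> (j, l) \<in> B \<longrightarrow> (i, l) \<in> B) \<and>
        ((i, l) \<in> B \<longrightarrow> (i, j) \<in> B \<or> (j, l) \<in> B))"

lemma biclosed_inv_set: "biclosed k (inv_set k \<alpha>)"
  unfolding biclosed_def inv_set_def pos_roots_def by auto

text \<open>Reversing the natural order on exactly the pairs in \<open>B\<close> gives a linear
  order; closure and co-closure are what makes it transitive. Ranking by this order yields the
  permutation.\<close>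

lemma biclosed_imp_inv_set:
  assumes "biclosed k B"
  shows "\<exists>\<alpha>. \<alpha> permutes {1..k} \<and> B = inv_set k \<alpha>"
proof -
  \<comment> \<open>\<open>prec j i\<close> prescribes that the value at \<open>j\<close> be smaller
    than the value at \<open>i\<close>. Below, \<open>\<alpha> i\<close> is the rank of
    \<open>i\<close>; \<open>Suc\<close> makes ranks start at 1, and \<open>\<alpha>\<close> is the
    identity outside \<open>{1..k}\<close>, as \<open>permutes\<close> demands.\<close>
  define prec where "prec j i \<longleftrightarrow> j < i \<and> (j, i) \<notin> B \<or> i < j \<and> (i, j) \<in> B" for i j
  define \<alpha> where "\<alpha> i = (if i \<in> {1..k} then Suc (card {j \<in> {1..k}. prec j i}) else i)" for i
  have sub: "B \<subseteq> pos_roots k" using assms by (simp add: biclosed_def)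
  have closed: "(i, l) \<in> B"
    if "1 \<le> i" "i < j" "j < l" "l \<le> k" "(i, j) \<in> B" "(j, l) \<in> B" for i j l
    using assms that unfolding biclosed_def by blast
  have coclosed: "(i, j) \<in> B \<or> (j, l) \<in> B"
    if "1 \<le> i" "i < j" "j < l" "l \<le> k" "(i, l) \<in> B" for i j l
    using assms that unfolding biclosed_def by blast
  have irrefl: "\<not> prec x x" for x by (simp add: prec_def)
  have asym: "\<not> prec y x" if "prec x y" for x y using that by (auto simp: prec_def)
  have total: "prec x y \<or> prec y x" if "x \<noteq> y" for x y
    using that by (auto simp: prec_def)
  have trans: "prec x z"
    if "x \<in> {1..k}" "y \<in> {1..k}" "z \<in> {1..k}" and xy: "prec x y" and yz: "prec y z" for x y z
  proof -
    have ne: "x \<noteq> y" "y \<noteq> z" "x \<noteq> z" using xy yz irrefl asym by blast+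
    have bnds: "1 \<le> x" "x \<le> k" "1 \<le> y" "y \<le> k" "1 \<le> z" "z \<le> k" using that by auto
    \<comment> \<open>One case for each relative order of the three numbers: co-closure serves when
      \<open>y\<close> is comparable to both others in the same direction, closure when
      \<open>y\<close> is the largest or the smallest.\<close>
    consider "x < y" "y < z" | "x < z" "z < y" | "y < x" "x < z"
      | "y < z" "z < x" | "z < x" "x < y" | "z < y" "y < x"
      using ne by linarith
    then show ?thesis
    proof cases
      case 1 then show ?thesis using xy yz bnds coclosed[of x y z] by (auto simp: prec_def)
    next
      case 2 then show ?thesis using xy yz bnds closed[of x z y] by (auto simp: prec_def)
    next
      case 3 then show ?thesis using xy yz bnds closed[of y x z] by (auto simp: prec_def)
    next
      case 4 then show ?thesis using xy yz bnds coclosed[of y z x] by (auto simp: prec_def)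
    next
      case 5 then show ?thesis using xy yz bnds coclosed[of z x y] by (auto simp: prec_def)
    next
      case 6 then show ?thesis using xy yz bnds closed[of z y x] by (auto simp: prec_def)
    qed
  qed
  have less: "\<alpha> x < \<alpha> y" if "x \<in> {1..k}" "y \<in> {1..k}" "prec x y" for x y
  proof -
    \<comment> \<open>The inclusion is strict because \<open>x\<close> itself precedes
      \<open>y\<close> but not \<open>x\<close>.\<close>
    have "{j \<in> {1..k}. prec j x} \<subset> {j \<in> {1..k}. prec j y}"
      using that trans irrefl by blast
    then have "card {j \<in> {1..k}. prec j x} < card {j \<in> {1..k}. prec j y}"
      by (intro psubset_card_mono) auto
    then show ?thesis using that by (simp add: \<alpha>_def)
  qed
  have inj: "inj_on \<alpha> {1..k}"
    by (rule inj_onI) (metis less total less_irrefl)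
  have "\<alpha> i \<in> {1..k}" if i: "i \<in> {1..k}" for i
  proof -
    have "card {j \<in> {1..k}. prec j i} < card {1..k}"
      using i irrefl[of i] by (intro psubset_card_mono) blast+
    then show ?thesis using i by (simp add: \<alpha>_def)
  qed
  then have "\<alpha> ` {1..k} = {1..k}"
    by (intro endo_inj_surj inj) auto
  then have "\<alpha> permutes {1..k}"
    using inj by (intro bij_imp_permutes) (auto simp: bij_betw_def \<alpha>_def)
  moreover have "(i, j) \<in> B \<longleftrightarrow> \<alpha> i > \<alpha> j" if ij: "(i, j) \<in> pos_roots k" for i j
  proof -
    have *: "i \<in> {1..k}" "j \<in> {1..k}" "i < j" using ij by (auto simp: pos_roots_def)
    show ?thesis
    proof (cases "(i, j) \<in> B")
      case True
      then show ?thesis using less[of j i] * by (auto simp: prec_def)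
    next
      case False
      then show ?thesis using less[of i j] * by (auto simp: prec_def)
    qed
  qed
  then have "B = inv_set k \<alpha>" using sub by (auto simp: inv_set_def)
  ultimately show ?thesis by blast
qed

lemma ex_inv_set_iff_biclosed:
  "(\<exists>\<alpha>. \<alpha> permutes {1..k} \<and> B = inv_set k \<alpha>) \<longleftrightarrow> biclosed k B"
  using biclosed_inv_set biclosed_imp_inv_set by blast

text \<open>Split \<open>(i, l)\<close> after its first step: by co-closure \<open>B\<close>
  contains the simple root \<open>(i, Suc i)\<close> or the shorter root
  \<open>(Suc i, l)\<close>.\<close>

lemma biclosed_has_simple_root:
  assumes "biclosed k B" "(i, l) \<in> B"
  shows "\<exists>j. 1 \<le> j \<and> j < k \<and> (j, Suc j) \<in> B"
  using assms(2)
proof (induction "l - i" arbitrary: i l rule: less_induct)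
  case less
  have il: "1 \<le> i" "i < l" "l \<le> k"
    using assms(1) less.prems by (auto simp: biclosed_def pos_roots_def)
  show ?case
  proof (cases "l = Suc i")
    case True
    then show ?thesis using less.prems il by (intro exI[of _ i]) auto
  next
    case False
    then have "i < Suc i" "Suc i < l" using il by auto
    then have "(i, Suc i) \<in> B \<or> (Suc i, l) \<in> B"
      using assms(1) less.prems il unfolding biclosed_def by blast
    then show ?thesis
    proof
      assume "(i, Suc i) \<in> B"
      then show ?thesis using il \<open>Suc i < l\<close> by (intro exI[of _ i]) auto
    next
      assume "(Suc i, l) \<in> B"
      then show ?thesis using less.hyps[of l "Suc i"] il by auto
    qed
  qed
qed

section \<open>Colourings of intervals and their recursive structure\<close>

text \<open>
  The root \<open>(i, j)\<close> stands for the interval \<open>{i..<j}\<close>. The colourings of the subintervals of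
  \<open>{a..<b}\<close> are set to 0 on all other pairs, so that they can be counted.
\<close>

definition colourings :: "nat \<Rightarrow> nat \<Rightarrow> (nat \<times> nat \<Rightarrow> nat) set" where
  "colourings a b = {c.
     (\<forall>i j. \<not> (a \<le> i \<and> i < j \<and> j \<le> b) \<longrightarrow> c (i, j) = 0) \<and>
     (\<forall>i. a \<le> i \<and> i < b \<longrightarrow> c (i, Suc i) = i) \<and>
     (\<forall>i j l. a \<le> i \<and> i < j \<and> j < l \<and> l \<le> b \<longrightarrow> c (i, l) = c (i, j) \<or> c (i, l) = c (j, l))}"

lemma
  assumes "c \<in> colourings a b"
  shows colourings_outside: "\<not> (a \<le> i \<and> i < j \<and> j \<le> b) \<Longrightarrow> c (i, j) = 0"
    and colourings_simple: "a \<le> i \<Longrightarrow> i < b \<Longrightarrow> c (i, Suc i) = i"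
    and colourings_split: "a \<le> i \<Longrightarrow> i < j \<Longrightarrow> j < l \<Longrightarrow> l \<le> b \<Longrightarrow>
      c (i, l) = c (i, j) \<or> c (i, l) = c (j, l)"
  using assms unfolding colourings_def by blast+

lemma colouring_in_interval:
  assumes c: "c \<in> colourings a b" and "a \<le> i" "i < j" "j \<le> b"
  shows "i \<le> c (i, j) \<and> c (i, j) < j"
  using assms(2-)
proof (induction "j - i" arbitrary: i j rule: less_induct)
  case less
  show ?case
  proof (cases "j = Suc i")
    case True
    then show ?thesis using colourings_simple[OF c, of i] less.prems by auto
  next
    case False
    then have "Suc i < j" using less.prems by auto
    then have "Suc i \<le> c (Suc i, j) \<and> c (Suc i, j) < j"
      using less.hyps[of j "Suc i"] less.prems by auto
    then show ?thesis
      using colourings_split[OF c, of i "Suc i" j] colourings_simple[OF c, of i] less.prems \<open>Suc i < j\<close>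
      by auto
  qed
qed

text \<open>Cut at \<open>i\<close>: the piece to the left has a colour below \<open>i\<close>, so
  the root colour must come from \<open>(i, b)\<close>. Then cut at \<open>j\<close>: the piece to
  the right has a colour at least \<open>j\<close>, so it must come from
  \<open>(i, j)\<close>.\<close>

lemma colouring_root:
  assumes c: "c \<in> colourings a b" and ij: "a \<le> i" "i \<le> c (a, b)" "c (a, b) < j" "j \<le> b"
  shows "c (i, j) = c (a, b)"
proof -
  have 1: "c (i, b) = c (a, b)"
  proof (cases "a = i")
    case False
    then show ?thesis
      using colourings_split[OF c, of a i b] colouring_in_interval[OF c, of a i] ij by auto
  qed auto
  show ?thesis
  proof (cases "j = b")
    case False
    then show ?thesis
      using colourings_split[OF c, of i j b] colouring_in_interval[OF c, of j b] ij 1 by auto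
  qed (use 1 in auto)
qed

definition restrict_colouring :: "nat \<Rightarrow> nat \<Rightarrow> (nat \<times> nat \<Rightarrow> nat) \<Rightarrow> nat \<times> nat \<Rightarrow> nat" where
  "restrict_colouring a b c = (\<lambda>(i, j). if a \<le> i \<and> i < j \<and> j \<le> b then c (i, j) else 0)"

text \<open>Intervals are half-open: \<open>j \<le> r\<close> puts \<open>{i..<j}\<close> wholly to
  the left of \<open>r\<close>, \<open>r < i\<close> wholly to the right, and otherwise
  \<open>r\<close> lies in it.\<close>

definition join_colourings ::
  "nat \<Rightarrow> nat \<Rightarrow> nat \<times> (nat \<times> nat \<Rightarrow> nat) \<times> (nat \<times> nat \<Rightarrow> nat) \<Rightarrow> nat \<times> nat \<Rightarrow> nat" where
  "join_colourings a b = (\<lambda>(r, c1, c2) (i, j).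
     if a \<le> i \<and> i < j \<and> j \<le> b then
       if j \<le> r then c1 (i, j) else if r < i then c2 (i, j) else r
     else 0)"

lemma restrict_colouring_in:
  assumes "c \<in> colourings a b" "a \<le> a'" "b' \<le> b"
  shows "restrict_colouring a' b' c \<in> colourings a' b'"
  using assms unfolding colourings_def restrict_colouring_def by auto

text \<open>If an interval containing \<open>r\<close> is cut in two, one piece still contains
  \<open>r\<close> and so has its colour; an interval avoiding \<open>r\<close> has all its pieces
  on the same side.\<close>

lemma join_colourings_in:
  assumes r: "a \<le> r" "r < b" and c1: "c1 \<in> colourings a r" and c2: "c2 \<in> colourings (Suc r) b"
  shows "join_colourings a b (r, c1, c2) \<in> colourings a b"
proof -
  let ?c = "join_colourings a b (r, c1, c2)"
  have "?c (i, Suc i) = i" if "a \<le> i" "i < b" for i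
    using that colourings_simple[OF c1, of i] colourings_simple[OF c2, of i]
    by (auto simp: join_colourings_def)
  moreover have "?c (i, l) = ?c (i, j) \<or> ?c (i, l) = ?c (j, l)"
    if "a \<le> i" "i < j" "j < l" "l \<le> b" for i j l
    using that colourings_split[OF c1, of i j l] colourings_split[OF c2, of i j l]
    by (auto simp: join_colourings_def)
  ultimately show ?thesis
    unfolding colourings_def by (auto simp: join_colourings_def)
qed

lemma join_restrict_colourings:
  assumes c: "c \<in> colourings a b"
  shows "join_colourings a b (c (a, b), restrict_colouring a (c (a, b)) c,
    restrict_colouring (Suc (c (a, b))) b c) = c"
proof (intro ext, clarify)
  fix i j
  show "join_colourings a b (c (a, b), restrict_colouring a (c (a, b)) c,
    restrict_colouring (Suc (c (a, b))) b c) (i, j) = c (i, j)"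
    using colouring_root[OF c, of i j] colourings_outside[OF c, of i j]
    by (auto simp: join_colourings_def restrict_colouring_def not_le not_less)
qed

lemma restrict_join_colourings:
  assumes r: "a \<le> r" "r < b" and c1: "c1 \<in> colourings a r" and c2: "c2 \<in> colourings (Suc r) b"
  shows "restrict_colouring a r (join_colourings a b (r, c1, c2)) = c1"
    and "restrict_colouring (Suc r) b (join_colourings a b (r, c1, c2)) = c2"
proof -
  have "restrict_colouring a r (join_colourings a b (r, c1, c2)) (i, j) = c1 (i, j)" for i j
    using colourings_outside[OF c1, of i j] r
    by (auto simp: join_colourings_def restrict_colouring_def)
  then show "restrict_colouring a r (join_colourings a b (r, c1, c2)) = c1" by auto
  have "restrict_colouring (Suc r) b (join_colourings a b (r, c1, c2)) (i, j) = c2 (i, j)" for i j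
    using colourings_outside[OF c2, of i j] r
    by (auto simp: join_colourings_def restrict_colouring_def)
  then show "restrict_colouring (Suc r) b (join_colourings a b (r, c1, c2)) = c2" by auto
qed

text \<open>The bijective form of the Catalan recurrence: \<open>r\<close> is the colour of the
  whole interval, which the inverse map reads off as \<open>c (a, b)\<close>. The value 0 outside
  the intervals makes both composites exact equalities of functions.\<close>

lemma bij_betw_colourings:
  assumes "a < b"
  shows "bij_betw (join_colourings a b)
    (SIGMA r:{a..<b}. colourings a r \<times> colourings (Suc r) b) (colourings a b)"
proof (rule bij_betw_byWitness[where f' = "\<lambda>c. (c (a, b),
    restrict_colouring a (c (a, b)) c, restrict_colouring (Suc (c (a, b))) b c)"])
  have join_root: "join_colourings a b (r, c1, c2) (a, b) = r" if "a \<le> r" "r < b" for r c1 c2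
    using that by (auto simp: join_colourings_def)
  show "\<forall>x\<in>SIGMA r:{a..<b}. colourings a r \<times> colourings (Suc r) b.
    (join_colourings a b x (a, b),
     restrict_colouring a (join_colourings a b x (a, b)) (join_colourings a b x),
     restrict_colouring (Suc (join_colourings a b x (a, b))) b (join_colourings a b x)) = x"
    using restrict_join_colourings join_root by auto
  show "(\<lambda>c. (c (a, b), restrict_colouring a (c (a, b)) c,
      restrict_colouring (Suc (c (a, b))) b c)) ` colourings a b
    \<subseteq> (SIGMA r:{a..<b}. colourings a r \<times> colourings (Suc r) b)"
  proof clarsimp
    fix c assume c: "c \<in> colourings a b"
    then have "a \<le> c (a, b) \<and> c (a, b) < b" using colouring_in_interval assms by blast
    then show "a \<le> c (a, b) \<and> c (a, b) < b \<and>
        restrict_colouring a (c (a, b)) c \<in> colourings a (c (a, b)) \<and>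
        restrict_colouring (Suc (c (a, b))) b c \<in> colourings (Suc (c (a, b))) b"
      using c by (auto intro!: restrict_colouring_in)
  qed
qed (use join_restrict_colourings join_colourings_in in auto)

section \<open>The Catalan recurrence and the number of colourings\<close>

definition catalan :: "nat \<Rightarrow> real" where
  "catalan n = real ((2 * n) choose n) / (real n + 1)"

text \<open>Two absorption identities, linked by the symmetry of row \<open>2 * n + 1\<close> of
  Pascal's triangle, give the ratio of consecutive central binomial coefficients.\<close>

lemma catalan_Suc: "(real n + 2) * catalan (Suc n) = (4 * real n + 2) * catalan n"
proof -
  have "Suc n * (2 * Suc n choose Suc n) = 2 * (2 * n + 1) * (2 * n choose n)"
  proof -
    have a: "Suc n * (Suc (Suc (2 * n)) choose Suc n) = Suc (Suc (2 * n)) * (Suc (2 * n) choose n)"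
      by (rule Suc_times_binomial)
    have "Suc n * (Suc (2 * n) choose Suc n) = Suc (2 * n) * (2 * n choose n)"
      by (rule Suc_times_binomial)
    moreover have "(Suc (2 * n) choose Suc n) = (Suc (2 * n) choose n)"
      using binomial_symmetric[of "Suc n" "Suc (2 * n)"] by simp
    ultimately have "Suc n * (Suc (2 * n) choose n) = Suc (2 * n) * (2 * n choose n)" by simp
    then show ?thesis using a by simp
  qed
  then have "real (Suc n) * real (2 * Suc n choose Suc n)
      = 2 * (2 * real n + 1) * real (2 * n choose n)"
    by (metis (no_types, lifting) of_nat_mult of_nat_add of_nat_numeral of_nat_1)
  then show ?thesis
    unfolding catalan_def by (simp add: field_simps del: binomial_Suc_Suc mult_Suc_right)
qed

text \<open>
  By symmetry, weighting the terms of the convolution by \<open>i + 1\<close> multiplies it by \<open>n/2 + 1\<close>; on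
  the other hand the weight turns \<open>C(i)\<close> into \<open>(4 (i - 1) + 2) C(i - 1)\<close>, which gives the previous
  convolution.
\<close>

lemma catalan_convolution: "(\<Sum>i\<le>n. catalan i * catalan (n - i)) = catalan (Suc n)"
proof (induction n)
  case 0
  then show ?case by (simp add: catalan_def)
next
  case (Suc n)
  \<comment> \<open>Reversing the summation replaces the weight \<open>i\<close> by
    \<open>m - i\<close>; the two weighted sums are equal and add up to \<open>m\<close> times the
    convolution.\<close>
  have sym: "(\<Sum>i\<le>m. real i * (catalan i * catalan (m - i)))
      = real m / 2 * (\<Sum>i\<le>m. catalan i * catalan (m - i))" for m
  proof -
    have "(\<Sum>i\<le>m. real i * (catalan i * catalan (m - i)))
        = (\<Sum>i\<le>m. real (m - i) * (catalan (m - i) * catalan (m - (m - i))))"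
      by (rule sum.atLeastAtMost_rev[where n = 0 and m = m, unfolded atLeast0AtMost, simplified])
    also have "\<dots> = (\<Sum>i\<le>m. (real m - real i) * (catalan i * catalan (m - i)))"
      by (intro sum.cong) (auto simp: of_nat_diff)
    also have "\<dots> = real m * (\<Sum>i\<le>m. catalan i * catalan (m - i))
        - (\<Sum>i\<le>m. real i * (catalan i * catalan (m - i)))"
      by (simp add: left_diff_distrib sum_subtractf sum_distrib_left)
    finally show ?thesis by simp
  qed
  let ?S = "\<Sum>i\<le>Suc n. catalan i * catalan (Suc n - i)"
  have "(real (Suc n) / 2 + 1) * ?S
      = (\<Sum>i\<le>Suc n. (real i + 1) * (catalan i * catalan (Suc n - i)))"
    using sym[of "Suc n"] by (simp add: distrib_right sum.distrib del: sum.atMost_Suc)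
  \<comment> \<open>The term for \<open>i = 0\<close> is split off; its weight and
    \<open>catalan 0\<close> are both 1.\<close>
  also have "\<dots> = catalan (Suc n)
      + (\<Sum>i\<le>n. (real (Suc i) + 1) * catalan (Suc i) * catalan (n - i))"
    by (subst sum.atMost_Suc_shift) (simp add: catalan_def[of 0] mult.assoc)
  also have "(\<Sum>i\<le>n. (real (Suc i) + 1) * catalan (Suc i) * catalan (n - i))
      = (\<Sum>i\<le>n. 4 * (real i * (catalan i * catalan (n - i))) + 2 * (catalan i * catalan (n - i)))"
    using catalan_Suc by (intro sum.cong) (auto simp: algebra_simps)
  also have "\<dots> = (2 * real n + 2) * catalan (Suc n)"
    using sym[of n] Suc.IH by (simp add: sum.distrib flip: sum_distrib_left) (simp add: algebra_simps)
  also have "catalan (Suc n) + \<dots> = (real (Suc n) / 2 + 1) * catalan (Suc (Suc n))"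
    using catalan_Suc[of "Suc n"] by (simp add: field_simps)
  finally have "(real (Suc n) / 2 + 1) * ?S = (real (Suc n) / 2 + 1) * catalan (Suc (Suc n))" .
  moreover have "real (Suc n) / 2 + 1 \<noteq> 0"
    by (smt (verit) of_nat_0_le_iff divide_nonneg_pos)
  ultimately show ?case by (simp only: mult_cancel_left) simp
qed

lemma card_colourings:
  assumes "a \<le> b"
  shows "finite (colourings a b) \<and> real (card (colourings a b)) = catalan (b - a)"
  using assms
proof (induction "b - a" arbitrary: a b rule: less_induct)
  case less
  show ?case
  proof (cases "a = b")
    case True
    then have "colourings a b = {\<lambda>_. 0}" by (auto simp: colourings_def)
    then show ?thesis using True by (simp add: catalan_def)
  next
    case False
    then have ab: "a < b" using less.prems by simp
    let ?S = "\<lambda>r. colourings a r \<times> colourings (Suc r) b"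
    have IH1: "finite (colourings a r) \<and> real (card (colourings a r)) = catalan (r - a)"
      and IH2: "finite (colourings (Suc r) b) \<and>
        real (card (colourings (Suc r) b)) = catalan (b - Suc r)" if "r \<in> {a..<b}" for r
      using that less.hyps[of r a] less.hyps[of b "Suc r"] by auto
    have fin: "\<forall>r\<in>{a..<b}. finite (?S r)" using IH1 IH2 by auto
    have "real (card (colourings a b)) = real (card (SIGMA r:{a..<b}. ?S r))"
      using bij_betw_same_card[OF bij_betw_colourings[OF ab]] by simp
    also have "\<dots> = (\<Sum>r\<in>{a..<b}. real (card (?S r)))"
      using fin by (subst card_SigmaI) auto
    also have "\<dots> = (\<Sum>r\<in>{a..<b}. catalan (r - a) * catalan (b - Suc r))"
      using IH1 IH2 by (intro sum.cong) (auto simp: card_cartesian_product)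
    \<comment> \<open>Here \<open>i\<close> is the length of the left interval; the two lengths add
      up to \<open>b - a - 1\<close> since position \<open>r\<close> belongs to neither.\<close>
    also have "\<dots> = (\<Sum>i\<le>b - a - 1. catalan i * catalan (b - a - 1 - i))"
      by (rule sum.reindex_bij_witness[of _ "\<lambda>i. i + a" "\<lambda>r. r - a"]) (use ab in auto)
    also have "\<dots> = catalan (b - a)"
      using catalan_convolution[of "b - a - 1"] ab by (simp add: Suc_diff_Suc)
    finally show ?thesis
      using bij_betw_finite[OF bij_betw_colourings[OF ab]] fin by auto
  qed
qed

section \<open>Colourings correspond to decompositions\<close>

definition colour_class :: "nat \<Rightarrow> (nat \<times> nat \<Rightarrow> nat) \<Rightarrow> nat \<Rightarrow> (nat \<times> nat) set" where
  "colour_class k c x = {p \<in> pos_roots k. c p = x}"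

lemma simple_root_in_colour_class:
  assumes "c \<in> colourings 1 k" "i \<in> {1..<k}"
  shows "(i, Suc i) \<in> colour_class k c x \<longleftrightarrow> x = i"
  using assms colourings_simple[OF assms(1), of i] by (auto simp: colour_class_def pos_roots_def)

text \<open>The splitting condition gives both halves: two pieces of equal colour force that colour
  on the whole, and the colour of the whole recurs on a piece.\<close>

lemma biclosed_colour_class:
  assumes "c \<in> colourings 1 k"
  shows "biclosed k (colour_class k c x)"
  unfolding biclosed_def
proof (intro conjI allI impI; (elim conjE)?)
  fix i j l :: nat
  assume ijl: "1 \<le> i" "i < j" "j < l" "l \<le> k"
  note split = colourings_split[OF assms ijl]
  show "(i, l) \<in> colour_class k c x"
    if "(i, j) \<in> colour_class k c x" "(j, l) \<in> colour_class k c x"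
    using that split ijl by (auto simp: colour_class_def pos_roots_def)
  show "(i, j) \<in> colour_class k c x \<or> (j, l) \<in> colour_class k c x"
    if "(i, l) \<in> colour_class k c x"
    using that split ijl by (auto simp: colour_class_def pos_roots_def)
qed (auto simp: colour_class_def)

lemma colour_classes_in_inv_decompositions:
  assumes c: "c \<in> colourings 1 (Suc n)"
  shows "colour_class (Suc n) c ` {1..n} \<in> inv_decompositions (Suc n) n"
proof -
  let ?C = "colour_class (Suc n) c"
  have simple: "(i, Suc i) \<in> ?C x \<longleftrightarrow> x = i" if "i \<in> {1..n}" for i x
    using simple_root_in_colour_class[OF c, of i x] that by auto
  have "c (i, j) \<in> {1..n}" if "(i, j) \<in> pos_roots (Suc n)" for i j
    using colouring_in_interval[OF c, of i j] that by (auto simp: pos_roots_def)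
  then have "\<Union> (?C ` {1..n}) = pos_roots (Suc n)"
    by (auto simp: colour_class_def)
  moreover have "disjoint (?C ` {1..n})"
    by (auto simp: disjoint_def colour_class_def)
  moreover have "{} \<notin> ?C ` {1..n}" using simple by blast
  moreover have "inj_on ?C {1..n}" using simple by (metis inj_onI)
  ultimately show ?thesis
    unfolding inv_decompositions_def partition_on_def ex_inv_set_iff_biclosed
    using biclosed_colour_class[OF c] by (auto simp: card_image)
qed

text \<open>The unordered set of classes still determines the colours, since the colour of a class
  is read off from the simple root in it.\<close>

lemma inj_on_colour_classes:
  "inj_on (\<lambda>c. colour_class (Suc n) c ` {1..n}) (colourings 1 (Suc n))"
proof (rule inj_onI)
  fix c d
  assume c: "c \<in> colourings 1 (Suc n)" and d: "d \<in> colourings 1 (Suc n)"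
    and eq: "colour_class (Suc n) c ` {1..n} = colour_class (Suc n) d ` {1..n}"
  have "c (i, j) = d (i, j)" for i j
  proof (cases "(i, j) \<in> pos_roots (Suc n)")
    case True
    let ?x = "c (i, j)"
    have x: "?x \<in> {1..n}"
      using colouring_in_interval[OF c, of i j] True by (auto simp: pos_roots_def)
    then obtain y where y: "colour_class (Suc n) c ?x = colour_class (Suc n) d y"
      using eq by blast
    then have "?x = y"
      using simple_root_in_colour_class[OF c, of ?x ?x] simple_root_in_colour_class[OF d, of ?x y] x
      by auto
    then have "(i, j) \<in> colour_class (Suc n) d ?x"
      using y True by (auto simp: colour_class_def)
    then show ?thesis by (simp add: colour_class_def)
  next
    case False
    then show ?thesis
      using colourings_outside[OF c, of i j] colourings_outside[OF d, of i j]
      by (auto simp: pos_roots_def)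
  qed
  then show "c = d" by auto
qed

lemma inv_decomposition_is_colour_classes:
  assumes P: "P \<in> inv_decompositions (Suc n) n"
  shows "\<exists>c\<in>colourings 1 (Suc n). P = colour_class (Suc n) c ` {1..n}"
proof -
  have un: "\<Union> P = pos_roots (Suc n)" and disj: "disjoint P" and ne: "{} \<notin> P"
    and bc: "\<And>B. B \<in> P \<Longrightarrow> biclosed (Suc n) B" and card: "card P = n"
    using P unfolding inv_decompositions_def partition_on_def ex_inv_set_iff_biclosed by blast+
  have same: "A = B" if "A \<in> P" "B \<in> P" "p \<in> A" "p \<in> B" for A B p
    using disj that by (auto simp: disjoint_def)
  have "\<exists>B\<in>P. (i, Suc i) \<in> B" if "i \<in> {1..n}" for i
  proof -
    have "(i, Suc i) \<in> \<Union> P" using that unfolding un by (auto simp: pos_roots_def)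
    then show ?thesis by blast
  qed
  then obtain g where g: "\<And>i. i \<in> {1..n} \<Longrightarrow> g i \<in> P \<and> (i, Suc i) \<in> g i" by metis
  have surj: "g ` {1..n} = P"
  proof
    \<comment> \<open>Each part contains some simple root \<open>(j, Suc j)\<close>, and by
      disjointness it is then the part \<open>g j\<close>.\<close>
    show "P \<subseteq> g ` {1..n}"
    proof
      fix B assume B: "B \<in> P"
      then obtain i l where "(i, l) \<in> B" using ne by (metis ex_in_conv surj_pair)
      then obtain j where j: "j \<in> {1..n}" "(j, Suc j) \<in> B"
        using biclosed_has_simple_root[OF bc[OF B]] by fastforce
      then show "B \<in> g ` {1..n}" using same[OF B] g by blast
    qed
  qed (use g in auto)
  \<comment> \<open>A map from \<open>n\<close> indices onto \<open>n\<close> parts is injective;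
    this is where the number of parts enters.\<close>
  have inj: "inj_on g {1..n}" by (rule eq_card_imp_inj_on) (simp_all only: surj card, simp_all)
  define c where "c p = (if p \<in> pos_roots (Suc n) then THE i. i \<in> {1..n} \<and> p \<in> g i else 0)" for p
  have c_eq: "c p = i" if "i \<in> {1..n}" "p \<in> g i" for i p
  proof -
    have "p \<in> pos_roots (Suc n)" using that g un by blast
    moreover have "(THE i. i \<in> {1..n} \<and> p \<in> g i) = i"
    proof (rule the_equality)
      fix m assume m: "m \<in> {1..n} \<and> p \<in> g m"
      then have "g m = g i" using that g same by blast
      then show "m = i" using inj m that(1) by (auto dest: inj_onD)
    qed (use that in simp)
    ultimately show ?thesis by (simp add: c_def)
  qed
  have c_ex: "c p \<in> {1..n} \<and> p \<in> g (c p)" if "p \<in> pos_roots (Suc n)" for p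
  proof -
    have "p \<in> \<Union> (g ` {1..n})" using that by (simp only: surj un)
    then obtain i where "i \<in> {1..n}" "p \<in> g i" by blast
    then show ?thesis using c_eq[of i p] by simp
  qed
  have classes: "colour_class (Suc n) c i = g i" if "i \<in> {1..n}" for i
  proof
    show "colour_class (Suc n) c i \<subseteq> g i" using c_ex by (auto simp: colour_class_def)
    show "g i \<subseteq> colour_class (Suc n) c i"
    proof
      fix p assume p: "p \<in> g i"
      then have "p \<in> pos_roots (Suc n)" using that g un by blast
      then show "p \<in> colour_class (Suc n) c i" using c_eq[OF that p] by (simp add: colour_class_def)
    qed
  qed
  have "c (i, l) = c (i, j) \<or> c (i, l) = c (j, l)"
    if "1 \<le> i" "i < j" "j < l" "l \<le> Suc n" for i j l
  proof -
    have "(i, l) \<in> pos_roots (Suc n)" using that by (auto simp: pos_roots_def)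
    then have x: "c (i, l) \<in> {1..n}" "(i, l) \<in> g (c (i, l))" using c_ex by auto
    \<comment> \<open>Co-closure of the part containing \<open>(i, l)\<close> becomes the splitting
      condition.\<close>
    then have "(i, j) \<in> g (c (i, l)) \<or> (j, l) \<in> g (c (i, l))"
      using bc[of "g (c (i, l))"] g that unfolding biclosed_def by blast
    then show ?thesis using c_eq x by metis
  qed
  moreover have "c (i, Suc i) = i" if "1 \<le> i" "i < Suc n" for i
    using that g[of i] c_eq[of i "(i, Suc i)"] by simp
  moreover have "c (i, j) = 0" if "\<not> (1 \<le> i \<and> i < j \<and> j \<le> Suc n)" for i j
    using that by (auto simp: c_def pos_roots_def)
  ultimately have "c \<in> colourings 1 (Suc n)" unfolding colourings_def by blast
  moreover have "colour_class (Suc n) c ` {1..n} = P"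
    unfolding surj[symmetric] by (rule image_cong[OF refl classes])
  ultimately show ?thesis by blast
qed

lemma Cat_A_eq_card_colourings: "Cat_A n = card (colourings 1 (Suc n))"
proof -
  have "(\<lambda>c. colour_class (Suc n) c ` {1..n}) ` colourings 1 (Suc n) = inv_decompositions (Suc n) n"
    using colour_classes_in_inv_decompositions inv_decomposition_is_colour_classes by blast
  then show ?thesis
    unfolding Cat_A_def using card_image[OF inj_on_colour_classes] by (metis Suc_eq_plus1)
qed

theorem lemma6p1:
  fixes n :: nat
  shows "real (Cat_A n) = 1 / (real n + 1) * real ((2 * n) choose n)"
  using card_colourings[of 1 "Suc n"] by (simp add: Cat_A_eq_card_colourings catalan_def)

end
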